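(* Assume that $M,N\colon G\to\mathbb C$ satisfy $\beta(M)\ge\beta(N)$ and $\Psi_M\Psi_{N,N}\ne0$. (i) Assume that $\Psi_M\overline{\Psi_{M,N}}\ne\Psi_N\Psi_{M,M}$. Then $\Psi_N\Psi_{M,N}\neq\Psi_M\Psi_{N,N}$, and hence, for $\alpha\in\mathbb C$, the maximum of $\beta(M+\alpha N)$ occurs for $$\alpha=\alpha_1:=\frac{\overline{\Psi_M}\Psi_{M,N}-\overline{\Psi_N}\Psi_{M,M}}{\overline{\Psi_N}\,\overline{\Psi_{M,N}}-\overline{\Psi_M}\Psi_{N,N}}$$ and is $$\beta(M+\alpha_1N)=\frac{|\Psi_N|^2\Psi_{M,M}+|\Psi_M|^2\Psi_{N,N}-2\mathrm{Re}(\overline{\Psi_M}\Psi_N\Psi_{M,N})}{\Psi_{M,M}\Psi_{N,N}-|\Psi_{M,N}|^2}=\beta(M)+\frac{|\overline{\Psi_M}\Psi_{M,N}-\overline{\Psi_N}\Psi_{M,M}|^2}{\Psi_{M,M}(\Psi_{M,M}\Psi_{N,N}-|\Psi_{M,N}|^2)},$$ where the denominators in these expressions for $\beta(M+\alpha_1N)$ are positive. In particular, $$\beta(M+\alpha_1N)>\beta(M).$$ (ii) Assume that $\Psi_M\overline{\Psi_{M,N}}=\Psi_N\Psi_{M,M}$. Then $\beta(M+\alpha N)\le\beta(M)$ for every $\alpha\in\mathbb C$.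
   Context: $G$ is an (indexing) set, $L\colon G\to\mathbb C$ is a function, and $w\colon G\to[0,\infty)$ is a weight function, not identically $0$. For $f\colon G\to\mathbb C$ put $\mathbb E^w_{\pi\in G}f(\pi):=\frac{\sum_{\pi\in G}w(\pi)f(\pi)}{\sum_{\pi\in G}w(\pi)}$. For $M,N\colon G\to\mathbb C$ define $\Psi_M:=\mathbb E^w_{\pi\in G}L(\pi)M(\pi)$, $\Psi_{M,N}:=\mathbb E^w_{\pi\in G}L(\pi)M(\pi)\overline{L(\pi)N(\pi)}$, and $\beta(M):=|\Psi_M|^2/\Psi_{M,M}$ if $\Psi_{M,M}\ne0$, $\beta(M):=0$ if $\Psi_{M,M}=0$. It is assumed that the series $\sum_\pi w(\pi)$ and $\sum_\pi w(\pi)|L(\pi)M(\pi)|^2$ converge for every function $M$ considered (automatic if $G$ is finite). *)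

theory Defs
  imports "HOL-Analysis.Analysis"
begin

text \<open>Sums over the indexing set are unconditional sums, so \<open>G\<close> may be finite or infinite.\<close>

definition wmean :: "'a set \<Rightarrow> ('a \<Rightarrow> real) \<Rightarrow> ('a \<Rightarrow> complex) \<Rightarrow> complex" where
  "wmean G w f =
     (\<Sum>\<^sub>\<infinity>\<pi>\<in>G. complex_of_real (w \<pi>) * f \<pi>) / complex_of_real (\<Sum>\<^sub>\<infinity>\<pi>\<in>G. w \<pi>)"

definition Psi1 :: "'a set \<Rightarrow> ('a \<Rightarrow> real) \<Rightarrow> ('a \<Rightarrow> complex) \<Rightarrow> ('a \<Rightarrow> complex) \<Rightarrow> complex" where
  "Psi1 G w L M = wmean G w (\<lambda>\<pi>. L \<pi> * M \<pi>)"

definition Psi2 ::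
  "'a set \<Rightarrow> ('a \<Rightarrow> real) \<Rightarrow> ('a \<Rightarrow> complex) \<Rightarrow> ('a \<Rightarrow> complex) \<Rightarrow> ('a \<Rightarrow> complex) \<Rightarrow> complex" where
  "Psi2 G w L M N = wmean G w (\<lambda>\<pi>. L \<pi> * M \<pi> * cnj (L \<pi> * N \<pi>))"

text \<open>
  \<open>Psi2 G w L M M\<close> is a real number (and nonnegative for nonnegative weights), so taking its
  real part in the definition of \<open>beta\<close> below only changes the type.
\<close>

lemma Psi2_self:
  "Psi2 G w L M M =
     complex_of_real ((\<Sum>\<^sub>\<infinity>\<pi>\<in>G. w \<pi> * (cmod (L \<pi> * M \<pi>))\<^sup>2) / (\<Sum>\<^sub>\<infinity>\<pi>\<in>G. w \<pi>))"
proof -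
  have "(\<Sum>\<^sub>\<infinity>\<pi>\<in>G. complex_of_real (w \<pi>) * (L \<pi> * M \<pi> * cnj (L \<pi> * M \<pi>))) =
        (\<Sum>\<^sub>\<infinity>\<pi>\<in>G. complex_of_real (w \<pi> * (cmod (L \<pi> * M \<pi>))\<^sup>2))"
    by (intro infsum_cong) (simp only: of_real_mult complex_norm_square)
  also have "\<dots> = complex_of_real (\<Sum>\<^sub>\<infinity>\<pi>\<in>G. w \<pi> * (cmod (L \<pi> * M \<pi>))\<^sup>2)"
    by (intro infsum_bounded_linear_strong bounded_linear_of_real iffI)
      (use summable_on_Re[of "\<lambda>\<pi>. complex_of_real (w \<pi> * (cmod (L \<pi> * M \<pi>))\<^sup>2)"]
         in simp, rule summable_on_of_real)
  finally show ?thesis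
    by (simp add: Psi2_def wmean_def)
qed

lemma Psi2_self_real: "Psi2 G w L M M \<in> \<real>"
  by (simp add: Psi2_self del: of_real_divide)

lemma Psi2_self_nonneg:
  assumes "\<And>\<pi>. \<pi> \<in> G \<Longrightarrow> w \<pi> \<ge> 0"
  shows "Re (Psi2 G w L M M) \<ge> 0"
  using assms by (simp add: Psi2_self infsum_nonneg del: of_real_divide)

definition beta :: "'a set \<Rightarrow> ('a \<Rightarrow> real) \<Rightarrow> ('a \<Rightarrow> complex) \<Rightarrow> ('a \<Rightarrow> complex) \<Rightarrow> real" where
  "beta G w L M =
     (if Psi2 G w L M M = 0 then 0 else (cmod (Psi1 G w L M))\<^sup>2 / Re (Psi2 G w L M M))"

end

theory Submission
  imports Defs
begin

text \<open>
  Everything follows from the inequality \<open>\<bar>P X\<bar>\<^sup>2 \<le> Q X X\<close> (Cauchy--Schwarz against the constant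
  function 1), applied to \<open>X = M + \<alpha> N\<close>. Write \<open>p = P M\<close>, \<open>q = P N\<close>, \<open>m = Q M M\<close>, \<open>n = Q N N\<close>,
  \<open>c = Q M N\<close>, \<open>\<Delta> = m n - \<bar>c\<bar>\<^sup>2\<close>, \<open>D \<alpha> = m + 2 Re (cnj \<alpha> c) + \<bar>\<alpha>\<bar>\<^sup>2 n\<close> and
  \<open>E = \<bar>q\<bar>\<^sup>2 m + \<bar>p\<bar>\<^sup>2 n - 2 Re (cnj p q c)\<close>, so that the quantity to maximise is
  \<open>\<bar>p + \<alpha> q\<bar>\<^sup>2 / D \<alpha>\<close>. The identity
  \<open>E D \<alpha> - \<Delta> \<bar>p + \<alpha> q\<bar>\<^sup>2 = \<bar>(cnj p c - cnj q m) - \<alpha> (cnj q cnj c - cnj p n)\<bar>\<^sup>2\<close>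
  shows that \<open>E / \<Delta>\<close> is the maximum, attained where the right-hand side vanishes, and its case
  \<open>\<alpha> = 0\<close> compares the maximum with \<open>\<bar>p\<bar>\<^sup>2 / m\<close>.
  If \<open>\<Delta> = 0\<close>, then \<open>D\<close>, and with it \<open>p + \<alpha> q\<close>, vanishes at \<open>\<alpha> = - c / n\<close>, which forces
  \<open>p cnj c = q m\<close>. Whenever the latter holds, \<open>m (p + \<alpha> q) = p (m + \<alpha> cnj c)\<close>, and
  \<open>m D \<alpha> = \<bar>m + \<alpha> cnj c\<bar>\<^sup>2 + \<Delta> \<bar>\<alpha>\<bar>\<^sup>2\<close> gives the bound in (ii).
\<close>

section \<open>Summability and algebra of weighted means\<close>

lemma weighted_product_summable:
  fixes w :: "'a \<Rightarrow> real" and f g :: "'a \<Rightarrow> complex"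
  assumes w: "\<And>x. x \<in> G \<Longrightarrow> w x \<ge> 0"
    and f: "(\<lambda>x. w x * (cmod (f x))\<^sup>2) summable_on G"
    and g: "(\<lambda>x. w x * (cmod (g x))\<^sup>2) summable_on G"
  shows "(\<lambda>x. complex_of_real (w x) * (f x * cnj (g x))) summable_on G"
proof (rule abs_summable_summable)
  have "(\<lambda>x. w x * (cmod (f x))\<^sup>2 + w x * (cmod (g x))\<^sup>2) summable_on G"
    using f g by (rule summable_on_add)
  then show "(\<lambda>x. norm (complex_of_real (w x) * (f x * cnj (g x)))) summable_on G"
  proof (rule summable_on_comparison_test)
    fix x assume x: "x \<in> G"
    \<comment> \<open>Bounding the product by the two squares dominates the series by a summable
      one, which gives absolute summability.\<close>
    have "cmod (f x) * cmod (g x) \<le> (cmod (f x))\<^sup>2 + (cmod (g x))\<^sup>2"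
      using sum_squares_bound[of "cmod (f x)" "cmod (g x)"]
        mult_nonneg_nonneg[OF norm_ge_zero[of "f x"] norm_ge_zero[of "g x"]] by linarith
    from mult_left_mono[OF this w[OF x]]
    show "norm (complex_of_real (w x) * (f x * cnj (g x)))
        \<le> w x * (cmod (f x))\<^sup>2 + w x * (cmod (g x))\<^sup>2"
      using w[OF x] by (simp add: norm_mult distrib_left)
  qed simp
qed

text \<open>Keeps \<open>M + \<alpha> N\<close> within the standing square-summability assumption;
  the dominating series comes from |x + y|^2 \<le> 2 |x|^2 + 2 |y|^2.\<close>

lemma weighted_square_summable_add:
  fixes w :: "'a \<Rightarrow> real" and f g :: "'a \<Rightarrow> complex"
  assumes w: "\<And>x. x \<in> G \<Longrightarrow> w x \<ge> 0"
    and f: "(\<lambda>x. w x * (cmod (f x))\<^sup>2) summable_on G"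
    and g: "(\<lambda>x. w x * (cmod (g x))\<^sup>2) summable_on G"
  shows "(\<lambda>x. w x * (cmod (f x + a * g x))\<^sup>2) summable_on G"
proof (rule summable_on_comparison_test)
  show "(\<lambda>x. 2 * (w x * (cmod (f x))\<^sup>2) + 2 * (cmod a)\<^sup>2 * (w x * (cmod (g x))\<^sup>2)) summable_on G"
    using f g by (intro summable_on_add summable_on_cmult_right)
  fix x assume x: "x \<in> G"
  have "(cmod (f x + a * g x))\<^sup>2 \<le> (cmod (f x) + cmod (a * g x))\<^sup>2"
    by (intro power_mono norm_triangle_ineq) simp
  also have "\<dots> \<le> 2 * (cmod (f x))\<^sup>2 + 2 * (cmod (a * g x))\<^sup>2"
    using sum_squares_bound[of "cmod (f x)" "cmod (a * g x)"] by (simp add: power2_sum)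
  finally show "w x * (cmod (f x + a * g x))\<^sup>2
      \<le> 2 * (w x * (cmod (f x))\<^sup>2) + 2 * (cmod a)\<^sup>2 * (w x * (cmod (g x))\<^sup>2)"
    using mult_left_mono[OF _ w[OF x]]
    by (fastforce simp: norm_mult power_mult_distrib algebra_simps)
  show "0 \<le> w x * (cmod (f x + a * g x))\<^sup>2" using w[OF x] by simp
qed

lemma wmean_add:
  assumes "(\<lambda>x. complex_of_real (w x) * f x) summable_on G"
    and "(\<lambda>x. complex_of_real (w x) * g x) summable_on G"
  shows "wmean G w (\<lambda>x. f x + g x) = wmean G w f + wmean G w g"
  by (simp add: wmean_def distrib_left infsum_add[OF assms] add_divide_distrib)

lemma wmean_cmult: "wmean G w (\<lambda>x. a * f x) = a * wmean G w f"
  by (simp add: wmean_def mult.left_commute[of _ a] infsum_cmult_right')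

lemma wmean_cnj: "wmean G w (\<lambda>x. cnj (f x)) = cnj (wmean G w f)"
proof -
  have "(\<Sum>\<^sub>\<infinity>x\<in>G. complex_of_real (w x) * cnj (f x)) =
      cnj (\<Sum>\<^sub>\<infinity>x\<in>G. complex_of_real (w x) * f x)"
    by (simp flip: infsum_cnj)
  then show ?thesis by (simp add: wmean_def)
qed

lemma wmean_one:
  assumes "(\<Sum>\<^sub>\<infinity>x\<in>G. w x) \<noteq> 0"
  shows "wmean G w (\<lambda>x. 1) = 1"
  \<comment> \<open>With both functions constantly 1, \<open>Psi2_self\<close> moves
    \<open>complex_of_real\<close> out of the infinite sum.\<close>
  using assms Psi2_self[of G w "\<lambda>x. 1" "\<lambda>x. 1"] by (simp add: Psi2_def)

lemma wmean_norm_square_add: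
  fixes f g :: "'a \<Rightarrow> complex"
  assumes w: "\<And>x. x \<in> G \<Longrightarrow> w x \<ge> 0"
    and f: "(\<lambda>x. w x * (cmod (f x))\<^sup>2) summable_on G"
    and g: "(\<lambda>x. w x * (cmod (g x))\<^sup>2) summable_on G"
  shows "wmean G w (\<lambda>x. (f x + a * g x) * cnj (f x + a * g x)) =
    wmean G w (\<lambda>x. f x * cnj (f x)) +
    complex_of_real (2 * Re (cnj a * wmean G w (\<lambda>x. f x * cnj (g x)))) +
    complex_of_real ((cmod a)\<^sup>2) * wmean G w (\<lambda>x. g x * cnj (g x))"
proof -
  have ff: "(\<lambda>x. complex_of_real (w x) * (f x * cnj (f x))) summable_on G"
    and fg: "(\<lambda>x. complex_of_real (w x) * (f x * cnj (g x))) summable_on G"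
    and gf: "(\<lambda>x. complex_of_real (w x) * (g x * cnj (f x))) summable_on G"
    and gg: "(\<lambda>x. complex_of_real (w x) * (g x * cnj (g x))) summable_on G"
    using weighted_product_summable[OF w f f] weighted_product_summable[OF w f g]
      weighted_product_summable[OF w g f] weighted_product_summable[OF w g g] by blast+
  have scale: "(\<lambda>x. complex_of_real (w x) * (b * h x)) summable_on G"
    if "(\<lambda>x. complex_of_real (w x) * h x) summable_on G" for b h
    using summable_on_cmult_right[OF that, of b] by (simp add: mult.left_commute)
  have sum2: "(\<lambda>x. complex_of_real (w x) * (h x + k x)) summable_on G"
    if "(\<lambda>x. complex_of_real (w x) * h x) summable_on G"
      "(\<lambda>x. complex_of_real (w x) * k x) summable_on G" for h k
    using summable_on_add[OF that] by (simp add: distrib_left)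
  have "wmean G w (\<lambda>x. (f x + a * g x) * cnj (f x + a * g x)) =
      wmean G w (\<lambda>x. f x * cnj (f x) + (cnj a * (f x * cnj (g x)) +
        (a * (g x * cnj (f x)) + (a * cnj a) * (g x * cnj (g x)))))"
    by (simp add: algebra_simps)
  also have "\<dots> = wmean G w (\<lambda>x. f x * cnj (f x)) +
      (cnj a * wmean G w (\<lambda>x. f x * cnj (g x)) +
        (a * wmean G w (\<lambda>x. g x * cnj (f x)) + (a * cnj a) * wmean G w (\<lambda>x. g x * cnj (g x))))"
    by (subst wmean_add, (intro ff fg gf gg scale sum2)+)+ (simp only: wmean_cmult)
  also have "wmean G w (\<lambda>x. g x * cnj (f x)) = cnj (wmean G w (\<lambda>x. f x * cnj (g x)))"
    by (simp add: mult.commute flip: wmean_cnj)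
  \<comment> \<open>The two cross terms are conjugate to each other, so together they give twice a
    real part.\<close>
  also have "cnj a * wmean G w (\<lambda>x. f x * cnj (g x)) +
      (a * cnj (wmean G w (\<lambda>x. f x * cnj (g x))) + (a * cnj a) * wmean G w (\<lambda>x. g x * cnj (g x))) =
      complex_of_real (2 * Re (cnj a * wmean G w (\<lambda>x. f x * cnj (g x)))) +
      complex_of_real ((cmod a)\<^sup>2) * wmean G w (\<lambda>x. g x * cnj (g x))"
    using complex_add_cnj[of "cnj a * wmean G w (\<lambda>x. f x * cnj (g x))"]
    by (simp only: complex_norm_square) (simp add: algebra_simps)
  finally show ?thesis by (simp add: add.assoc)
qed

section \<open>\<open>Psi1\<close> and \<open>Psi2\<close> along the line
  \<open>M + \<alpha> N\<close>\<close>

lemma Psi1_add: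
  assumes w: "\<And>x. x \<in> G \<Longrightarrow> w x \<ge> 0" and "w summable_on G"
    and M: "(\<lambda>x. w x * (cmod (L x * M x))\<^sup>2) summable_on G"
    and N: "(\<lambda>x. w x * (cmod (L x * N x))\<^sup>2) summable_on G"
  shows "Psi1 G w L (\<lambda>x. M x + a * N x) = Psi1 G w L M + a * Psi1 G w L N"
proof -
  \<comment> \<open>The constant 1 is square summable against \<open>w\<close>, so a linear term is
    summable as a product with 1.\<close>
  have one: "(\<lambda>x. w x * (cmod 1)\<^sup>2) summable_on G" using assms(2) by simp
  have "(\<lambda>x. complex_of_real (w x) * (L x * M x)) summable_on G"
    using weighted_product_summable[OF w M one] by simp
  moreover have "(\<lambda>x. complex_of_real (w x) * (a * (L x * N x))) summable_on G"
    using summable_on_cmult_right[OF weighted_product_summable[OF w N one], of a]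
    by (simp add: mult.left_commute)
  ultimately show ?thesis
    by (simp add: Psi1_def distrib_left mult.left_commute[of _ a] wmean_add wmean_cmult)
qed

lemma Psi2_add:
  assumes "\<And>x. x \<in> G \<Longrightarrow> w x \<ge> 0"
    and "(\<lambda>x. w x * (cmod (L x * M x))\<^sup>2) summable_on G"
    and "(\<lambda>x. w x * (cmod (L x * N x))\<^sup>2) summable_on G"
  shows "Psi2 G w L (\<lambda>x. M x + a * N x) (\<lambda>x. M x + a * N x) =
    Psi2 G w L M M + complex_of_real (2 * Re (cnj a * Psi2 G w L M N)) +
    complex_of_real ((cmod a)\<^sup>2) * Psi2 G w L N N"
  using wmean_norm_square_add[OF assms, of a]
  by (simp add: Psi2_def distrib_left mult.left_commute[of _ a])

text \<open>The difference of the two sides is a variance: the weighted mean of |L M - p|^2, where p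
  is the mean of L M.\<close>

lemma Psi1_square_le_Psi2:
  assumes w: "\<And>x. x \<in> G \<Longrightarrow> w x \<ge> 0" and "w summable_on G"
    and "(\<Sum>\<^sub>\<infinity>x\<in>G. w x) \<noteq> 0"
    and M: "(\<lambda>x. w x * (cmod (L x * M x))\<^sup>2) summable_on G"
  shows "(cmod (Psi1 G w L M))\<^sup>2 \<le> Re (Psi2 G w L M M)"
proof -
  define p where "p = Psi1 G w L M"
  \<comment> \<open>Taking 1 in the role of \<open>L\<close> and writing the shift as
    \<open>- p * 1\<close> makes \<open>Psi2_add\<close> expand the variance.\<close>
  have "0 \<le> Re (Psi2 G w (\<lambda>x. 1) (\<lambda>x. L x * M x + - p * 1) (\<lambda>x. L x * M x + - p * 1))"
    by (rule Psi2_self_nonneg) (rule w)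
  also have "\<dots> = Re (Psi2 G w L M M) + 2 * Re (cnj (- p) * p) + (cmod p)\<^sup>2"
    using assms by (subst Psi2_add)
      (simp_all add: Psi2_def Psi1_def p_def wmean_one)
  also have "2 * Re (cnj (- p) * p) = - 2 * (cmod p)\<^sup>2"
    by (simp add: cmod_power2) (simp add: power2_eq_square)
  finally show ?thesis by (simp add: p_def)
qed

section \<open>Maximising a quotient of two quadratic expressions in one complex variable\<close>

text \<open>This is Lagrange's identity: the defect in Cauchy-Schwarz between the Hermitian form
  with matrix (m, c; cnj c, n) at (1, a) and its adjugate form at (p, q).\<close>

lemma quotient_identity:
  fixes p q c a :: complex and m n :: real
  shows "((cmod q)\<^sup>2 * m + (cmod p)\<^sup>2 * n - 2 * Re (cnj p * q * c)) *
      (m + 2 * Re (cnj a * c) + (cmod a)\<^sup>2 * n) =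
    (m * n - (cmod c)\<^sup>2) * (cmod (p + a * q))\<^sup>2 +
    (cmod ((cnj p * c - cnj q * of_real m) - a * (cnj q * cnj c - cnj p * of_real n)))\<^sup>2"
  by (simp add: cmod_power2) algebra

lemma quotient_completed_square:
  fixes c a :: complex and m n :: real
  shows "m * (m + 2 * Re (cnj a * c) + (cmod a)\<^sup>2 * n) =
    (cmod (of_real m + a * cnj c))\<^sup>2 + (m * n - (cmod c)\<^sup>2) * (cmod a)\<^sup>2"
  by (simp add: cmod_power2) algebra

context
  fixes p q c :: complex and m n :: real and D :: "complex \<Rightarrow> real"
  assumes n: "n > 0"
    and D_def: "D = (\<lambda>a. m + 2 * Re (cnj a * c) + (cmod a)\<^sup>2 * n)"
    and bound: "\<And>a. (cmod (p + a * q))\<^sup>2 \<le> D a"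
    and p: "p \<noteq> 0"
begin

lemma quotient_m_pos: "m > 0"
proof -
  have "0 < (cmod p)\<^sup>2" using p by simp
  also have "\<dots> \<le> m" using bound[of 0] by (simp add: D_def)
  finally show ?thesis .
qed

text \<open>Completes the square in \<open>a\<close>, which exhibits the vertex
  \<open>- c / n\<close> of \<open>D\<close>; \<open>quotient_completed_square\<close> does the same
  with the roles of \<open>m\<close> and \<open>n\<close> exchanged.\<close>

lemma quotient_n_mult: "n * D a = (cmod (of_real n * a + c))\<^sup>2 + (m * n - (cmod c)\<^sup>2)"
  unfolding D_def by (simp add: cmod_power2) algebra

lemma quotient_D_vertex: "n * D (- c / of_real n) = m * n - (cmod c)\<^sup>2"
  using n by (simp add: quotient_n_mult)

text \<open>\<open>bound\<close> makes \<open>D\<close> nonnegative everywhere, hence at its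
  vertex.\<close>

lemma quotient_gram_nonneg: "m * n - (cmod c)\<^sup>2 \<ge> 0"
proof -
  have "0 \<le> D (- c / of_real n)" by (rule order_trans[OF _ bound]) simp
  then show ?thesis using n quotient_D_vertex by (metis mult_nonneg_nonneg less_imp_le)
qed

lemma quotient_gram_pos:
  assumes "p * cnj c \<noteq> q * of_real m"
  shows "m * n - (cmod c)\<^sup>2 > 0"
proof (rule ccontr)
  assume "\<not> ?thesis"
  with quotient_gram_nonneg have eq: "m * n - (cmod c)\<^sup>2 = 0" by linarith
  with quotient_D_vertex n have "D (- c / of_real n) = 0" by simp
  with bound[of "- c / of_real n"] have "p = c / of_real n * q" by simp
  then have "p * cnj c = q * (c * cnj c) / of_real n" by simp
  also have "c * cnj c = of_real (m * n)"
    using eq by (simp flip: complex_norm_square)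
  finally show False using assms n by simp
qed

lemma quotient_le_of_eq:
  assumes "p * cnj c = q * of_real m"
  shows "(cmod (p + a * q))\<^sup>2 / D a \<le> (cmod p)\<^sup>2 / m"
proof (cases "D a = 0")
  \<comment> \<open>Division by zero yields 0, so only nonnegativity of the right-hand side is at
    stake.\<close>
  case True
  then show ?thesis using quotient_m_pos by simp
next
  case False
  then have Da: "D a > 0" using order_trans[OF zero_le_power2 bound[of a]] by simp
  have "of_real m * (p + a * q) = p * (of_real m + a * cnj c)"
    using assms by (simp add: algebra_simps)
  then have "m\<^sup>2 * (cmod (p + a * q))\<^sup>2 = (cmod p)\<^sup>2 * (cmod (of_real m + a * cnj c))\<^sup>2"
    by (metis norm_mult norm_of_real power2_abs power_mult_distrib)
  also have "\<dots> \<le> (cmod p)\<^sup>2 * (m * D a)"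
    unfolding D_def quotient_completed_square
    using quotient_gram_nonneg by (intro mult_left_mono) simp_all
  finally have "m * (m * (cmod (p + a * q))\<^sup>2) \<le> m * ((cmod p)\<^sup>2 * D a)"
    by (simp add: power2_eq_square mult_ac)
  then have "m * (cmod (p + a * q))\<^sup>2 \<le> (cmod p)\<^sup>2 * D a"
    using quotient_m_pos by (simp add: mult_le_cancel_left_pos)
  then show ?thesis using Da quotient_m_pos by (simp add: field_simps)
qed

section \<open>The nondegenerate case, in which the maximum exceeds the value at
  \<open>a = 0\<close>\<close>

context
  fixes \<Delta> E :: real
  assumes gram: "p * cnj c \<noteq> q * of_real m"
    and \<Delta>_def: "\<Delta> = m * n - (cmod c)\<^sup>2"
    and E_def: "E = (cmod q)\<^sup>2 * m + (cmod p)\<^sup>2 * n - 2 * Re (cnj p * q * c)"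
begin

lemma quotient_\<Delta>_pos: "\<Delta> > 0"
  using quotient_gram_pos[OF gram] by (simp add: \<Delta>_def)

lemma quotient_D_pos: "D a > 0"
proof -
  have "n * D a > 0"
    unfolding quotient_n_mult using quotient_\<Delta>_pos by (simp add: \<Delta>_def add_nonneg_pos)
  then show ?thesis using n by (simp add: zero_less_mult_iff)
qed

text \<open>Here \<beta>(N) \<le> \<beta>(M) enters. Under equality the supremum would be approached
  only as \<open>a\<close> tends to infinity, with limit |q|^2 / n, and would exceed |p|^2 / m. The
  proof compares squared moduli and contradicts \<open>\<Delta> > 0\<close>.\<close>

lemma quotient_denominator_nonzero:
  assumes le: "(cmod q)\<^sup>2 / n \<le> (cmod p)\<^sup>2 / m"
  shows "q * c \<noteq> p * of_real n"
proof
  assume eq: "q * c = p * of_real n"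
  then have q: "q \<noteq> 0" using p n by auto
  have "(cmod q)\<^sup>2 * (cmod c)\<^sup>2 = ((cmod p)\<^sup>2 * n) * n"
    using arg_cong[OF eq, of "\<lambda>z. (cmod z)\<^sup>2"] n
    by (simp add: norm_mult power_mult_distrib power2_eq_square[of n])
  also have "\<dots> \<ge> ((cmod q)\<^sup>2 * m) * n"
    using le n quotient_m_pos by (intro mult_right_mono) (simp_all add: field_simps)
  finally have "(cmod q)\<^sup>2 * \<Delta> \<le> 0" by (simp add: \<Delta>_def algebra_simps)
  then show False using q quotient_\<Delta>_pos by (simp add: mult_le_0_iff)
qed

lemma quotient_le: "(cmod (p + a * q))\<^sup>2 / D a \<le> E / \<Delta>"
proof -
  have "E * D a = \<Delta> * (cmod (p + a * q))\<^sup>2 +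
      (cmod ((cnj p * c - cnj q * of_real m) - a * (cnj q * cnj c - cnj p * of_real n)))\<^sup>2"
    unfolding D_def E_def \<Delta>_def by (rule quotient_identity)
  then have "(cmod (p + a * q))\<^sup>2 * \<Delta> \<le> E * D a" by (simp add: mult.commute)
  then show ?thesis
    using quotient_D_pos[of a] quotient_\<Delta>_pos by (simp add: field_simps)
qed

lemma quotient_attained:
  assumes "q * c \<noteq> p * of_real n"
    and a: "a = (cnj p * c - cnj q * of_real m) / (cnj q * cnj c - cnj p * of_real n)"
  shows "(cmod (p + a * q))\<^sup>2 / D a = E / \<Delta>"
proof -
  \<comment> \<open>The denominator of \<open>a\<close> is the conjugate of
    \<open>q * c - p * of_real n\<close>.\<close>
  have "cnj (q * c) \<noteq> cnj (p * of_real n)" using assms(1) by (simp only: complex_cnj_cancel_iff) simp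
  then have "a * (cnj q * cnj c - cnj p * of_real n) = cnj p * c - cnj q * of_real m"
    by (simp add: a)
  then have "E * D a = \<Delta> * (cmod (p + a * q))\<^sup>2"
    using quotient_identity[of q m p n c a] by (simp add: D_def E_def \<Delta>_def)
  then show ?thesis
    using quotient_D_pos[of a] quotient_\<Delta>_pos by (simp add: field_simps)
qed

lemma quotient_max_eq:
  "E / \<Delta> = (cmod p)\<^sup>2 / m + (cmod (cnj p * c - cnj q * of_real m))\<^sup>2 / (m * \<Delta>)"
proof -
  have "E * m = \<Delta> * (cmod p)\<^sup>2 + (cmod (cnj p * c - cnj q * of_real m))\<^sup>2"
    using quotient_identity[of q m p n c 0] by (simp add: E_def \<Delta>_def)
  then show ?thesis
    using quotient_m_pos quotient_\<Delta>_pos by (simp add: field_simps)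
qed

lemma quotient_max_gt: "(cmod p)\<^sup>2 / m < E / \<Delta>"
proof -
  \<comment> \<open>Conjugating \<open>gram\<close> shows that the square added in
    \<open>quotient_max_eq\<close> is nonzero.\<close>
  have "cnj (p * cnj c) \<noteq> cnj (q * of_real m)" using gram by (simp only: complex_cnj_cancel_iff) simp
  then have "(cmod (cnj p * c - cnj q * of_real m))\<^sup>2 > 0" by simp
  then show ?thesis
    unfolding quotient_max_eq using quotient_m_pos quotient_\<Delta>_pos by simp
qed

end

end

section \<open>Transfer to \<open>beta\<close>\<close>

theorem corollary2p6:
  fixes G :: "'a set" and w :: "'a \<Rightarrow> real" and L M N :: "'a \<Rightarrow> complex"
    and P :: "('a \<Rightarrow> complex) \<Rightarrow> complex"
    and Q :: "('a \<Rightarrow> complex) \<Rightarrow> ('a \<Rightarrow> complex) \<Rightarrow> complex"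
    and B :: "('a \<Rightarrow> complex) \<Rightarrow> real"
    and \<alpha>\<^sub>1 :: complex
  defines "P \<equiv> Psi1 G w L" and "Q \<equiv> Psi2 G w L" and "B \<equiv> beta G w L"
    and "\<alpha>\<^sub>1 \<equiv> (cnj (P M) * Q M N - cnj (P N) * Q M M) /
               (cnj (P N) * cnj (Q M N) - cnj (P M) * Q N N)"
  assumes w_nonneg: "\<And>\<pi>. \<pi> \<in> G \<Longrightarrow> w \<pi> \<ge> 0"
    and w_nonzero: "\<exists>\<pi>\<in>G. w \<pi> \<noteq> 0"
    and w_summable: "w summable_on G"
    and M_summable: "(\<lambda>\<pi>. w \<pi> * (cmod (L \<pi> * M \<pi>))\<^sup>2) summable_on G"
    and N_summable: "(\<lambda>\<pi>. w \<pi> * (cmod (L \<pi> * N \<pi>))\<^sup>2) summable_on G"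
    and beta_le: "B M \<ge> B N"
    and nonzero: "P M * Q N N \<noteq> 0"
  shows
    "(P M * cnj (Q M N) \<noteq> P N * Q M M \<longrightarrow>
        P N * Q M N \<noteq> P M * Q N N \<and>
        (\<forall>\<alpha>. B (\<lambda>\<pi>. M \<pi> + \<alpha> * N \<pi>) \<le> B (\<lambda>\<pi>. M \<pi> + \<alpha>\<^sub>1 * N \<pi>)) \<and>
        complex_of_real (B (\<lambda>\<pi>. M \<pi> + \<alpha>\<^sub>1 * N \<pi>)) =
          (complex_of_real ((cmod (P N))\<^sup>2) * Q M M + complex_of_real ((cmod (P M))\<^sup>2) * Q N N
             - complex_of_real (2 * Re (cnj (P M) * P N * Q M N))) /
          (Q M M * Q N N - complex_of_real ((cmod (Q M N))\<^sup>2)) \<and>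
        complex_of_real (B (\<lambda>\<pi>. M \<pi> + \<alpha>\<^sub>1 * N \<pi>)) =
          complex_of_real (B M) +
          complex_of_real ((cmod (cnj (P M) * Q M N - cnj (P N) * Q M M))\<^sup>2) /
          (Q M M * (Q M M * Q N N - complex_of_real ((cmod (Q M N))\<^sup>2))) \<and>
        Q M M * Q N N - complex_of_real ((cmod (Q M N))\<^sup>2) \<in> \<real> \<and>
        Re (Q M M * Q N N - complex_of_real ((cmod (Q M N))\<^sup>2)) > 0 \<and>
        Q M M * (Q M M * Q N N - complex_of_real ((cmod (Q M N))\<^sup>2)) \<in> \<real> \<and>
        Re (Q M M * (Q M M * Q N N - complex_of_real ((cmod (Q M N))\<^sup>2))) > 0 \<and>
        B (\<lambda>\<pi>. M \<pi> + \<alpha>\<^sub>1 * N \<pi>) > B M) \<and>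
     (P M * cnj (Q M N) = P N * Q M M \<longrightarrow>
        (\<forall>\<alpha>. B (\<lambda>\<pi>. M \<pi> + \<alpha> * N \<pi>) \<le> B M))"
proof -
  \<comment> \<open>A nonzero total weight is what gives the constant 1 mean 1 in the variance
    argument.\<close>
  have W: "(\<Sum>\<^sub>\<infinity>\<pi>\<in>G. w \<pi>) \<noteq> 0"
  proof
    assume "(\<Sum>\<^sub>\<infinity>\<pi>\<in>G. w \<pi>) = 0"
    then have "w \<pi> = 0" if "\<pi> \<in> G" for \<pi>
      by (intro nonneg_infsum_le_0D[OF _ w_summable w_nonneg that]) simp_all
    then show False using w_nonzero by blast
  qed
  define p q c where pqc: "p = P M" "q = P N" "c = Q M N"
  define m n where mn: "m = Re (Q M M)" "n = Re (Q N N)"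
  define D where "D = (\<lambda>a. m + 2 * Re (cnj a * c) + (cmod a)\<^sup>2 * n)"
  define \<Delta> where "\<Delta> = m * n - (cmod c)\<^sup>2"
  define E where "E = (cmod q)\<^sup>2 * m + (cmod p)\<^sup>2 * n - 2 * Re (cnj p * q * c)"
  have QM: "Q M M = of_real m" and QN: "Q N N = of_real n"
    unfolding mn Q_def by (simp_all only: of_real_Re[OF Psi2_self_real])
  have p: "p \<noteq> 0" and "n \<noteq> 0" using nonzero by (simp_all add: pqc QN)
  moreover have "n \<ge> 0"
    unfolding mn Q_def by (rule Psi2_self_nonneg) (rule w_nonneg)
  ultimately have n: "n > 0" by linarith
  have QX: "Q (\<lambda>\<pi>. M \<pi> + a * N \<pi>) (\<lambda>\<pi>. M \<pi> + a * N \<pi>) = of_real (D a)" for a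
    using Psi2_add[OF w_nonneg M_summable N_summable, of a]
    by (simp add: D_def pqc QM QN flip: Q_def)
  have PX: "P (\<lambda>\<pi>. M \<pi> + a * N \<pi>) = p + a * q" for a
    using Psi1_add[OF w_nonneg w_summable M_summable N_summable, of a] by (simp add: P_def pqc)
  have sX: "(\<lambda>\<pi>. w \<pi> * (cmod (L \<pi> * (M \<pi> + a * N \<pi>)))\<^sup>2) summable_on G" for a
    using weighted_square_summable_add[OF w_nonneg M_summable N_summable, of a]
    by (simp add: distrib_left mult.left_commute)
  have bound: "(cmod (p + a * q))\<^sup>2 \<le> D a" for a
    using Psi1_square_le_Psi2[OF w_nonneg w_summable W sX[of a]] PX[of a] QX[of a]
    by (simp add: P_def Q_def)
  \<comment> \<open>This covers \<open>D a = 0\<close> too: division by zero agrees with the default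
    value 0 in \<open>beta\<close>.\<close>
  have BX: "B (\<lambda>\<pi>. M \<pi> + a * N \<pi>) = (cmod (p + a * q))\<^sup>2 / D a" for a
    using PX[of a] QX[of a] by (simp add: B_def beta_def P_def Q_def)
  have BM: "B M = (cmod p)\<^sup>2 / m" using BX[of 0] by (simp add: D_def)
  have BN: "B N = (cmod q)\<^sup>2 / n"
    using QN n by (simp add: B_def beta_def pqc P_def Q_def)
  note ctx = n D_def bound p
  have \<alpha>\<^sub>1: "\<alpha>\<^sub>1 = (cnj p * c - cnj q * of_real m) / (cnj q * cnj c - cnj p * of_real n)"
    by (simp add: \<alpha>\<^sub>1_def pqc QM QN)
  \<comment> \<open>All complex expressions in the claim whose sign or quotient matters are real, so
    it reduces to real numbers \<open>\<Delta>\<close> and \<open>E\<close>.\<close>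
  have real_forms: "Q M M * Q N N - complex_of_real ((cmod (Q M N))\<^sup>2) = of_real \<Delta>"
    "complex_of_real ((cmod (P N))\<^sup>2) * Q M M + complex_of_real ((cmod (P M))\<^sup>2) * Q N N
       - complex_of_real (2 * Re (cnj (P M) * P N * Q M N)) = of_real E"
    by (simp_all only: \<Delta>_def E_def pqc QM QN of_real_add of_real_diff of_real_mult)
  show ?thesis
    unfolding real_forms
  proof (rule conjI; rule impI)
    assume "P M * cnj (Q M N) \<noteq> P N * Q M M"
    then have gram: "p * cnj c \<noteq> q * of_real m" by (simp add: pqc QM)
    note ctx2 = ctx gram \<Delta>_def E_def
    have denom: "q * c \<noteq> p * of_real n"
      using beta_le by (intro quotient_denominator_nonzero[OF ctx2]) (simp add: BM BN)
    have max: "B (\<lambda>\<pi>. M \<pi> + \<alpha>\<^sub>1 * N \<pi>) = E / \<Delta>"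
      unfolding BX by (rule quotient_attained[OF ctx2 denom \<alpha>\<^sub>1])
    have "P N * Q M N \<noteq> P M * Q N N"
      using denom by (simp add: pqc QN)
    moreover have "\<forall>\<alpha>. B (\<lambda>\<pi>. M \<pi> + \<alpha> * N \<pi>) \<le> B (\<lambda>\<pi>. M \<pi> + \<alpha>\<^sub>1 * N \<pi>)"
      unfolding max BX by (intro allI quotient_le[OF ctx2])
    moreover have "complex_of_real (B (\<lambda>\<pi>. M \<pi> + \<alpha>\<^sub>1 * N \<pi>)) = of_real E / of_real \<Delta>"
      by (simp add: max)
    moreover have "complex_of_real (B (\<lambda>\<pi>. M \<pi> + \<alpha>\<^sub>1 * N \<pi>)) = complex_of_real (B M) +
        complex_of_real ((cmod (cnj (P M) * Q M N - cnj (P N) * Q M M))\<^sup>2) / (Q M M * of_real \<Delta>)"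
      unfolding max BM quotient_max_eq[OF ctx2] by (simp add: pqc QM)
    moreover have "B (\<lambda>\<pi>. M \<pi> + \<alpha>\<^sub>1 * N \<pi>) > B M"
      unfolding max BM by (rule quotient_max_gt[OF ctx2])
    ultimately show "P N * Q M N \<noteq> P M * Q N N \<and>
        (\<forall>\<alpha>. B (\<lambda>\<pi>. M \<pi> + \<alpha> * N \<pi>) \<le> B (\<lambda>\<pi>. M \<pi> + \<alpha>\<^sub>1 * N \<pi>)) \<and>
        complex_of_real (B (\<lambda>\<pi>. M \<pi> + \<alpha>\<^sub>1 * N \<pi>)) = of_real E / of_real \<Delta> \<and>
        complex_of_real (B (\<lambda>\<pi>. M \<pi> + \<alpha>\<^sub>1 * N \<pi>)) = complex_of_real (B M) +
          complex_of_real ((cmod (cnj (P M) * Q M N - cnj (P N) * Q M M))\<^sup>2) /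
          (Q M M * of_real \<Delta>) \<and>
        complex_of_real \<Delta> \<in> \<real> \<and> Re (complex_of_real \<Delta>) > 0 \<and>
        Q M M * of_real \<Delta> \<in> \<real> \<and> Re (Q M M * of_real \<Delta>) > 0 \<and>
        B (\<lambda>\<pi>. M \<pi> + \<alpha>\<^sub>1 * N \<pi>) > B M"
      using quotient_m_pos[OF ctx] quotient_\<Delta>_pos[OF ctx2]
      by (intro conjI) (simp_all add: QM)
  next
    assume "P M * cnj (Q M N) = P N * Q M M"
    then have "p * cnj c = q * of_real m" by (simp add: pqc QM)
    then show "\<forall>\<alpha>. B (\<lambda>\<pi>. M \<pi> + \<alpha> * N \<pi>) \<le> B M"
      unfolding BX BM by (intro allI quotient_le_of_eq[OF ctx])
  qed
qed

end
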